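(* Consider an integral polymatroid congestion game with strategy spaces $X_i=\mathcal{B}_{f_i}\subset\{0,1\}^m$, $i\in N$, where each $f_i:2^E\to\mathbb{Z}$ is an integral polymatroid rank function, and nondecreasing player-specific separable cost functions $c_{ij}$, $i\in N$, $j\in E$. Let $u\in\mathbb{Z}^m$ be minimal for $X$. Then $u$ is enforceable.
   Context: Setting. $E=\{1,\dots,m\}$, $N=\{1,\dots,n\}$ are finite nonempty sets. An integral polymatroid rank function is a submodular, monotone function $f:2^E\to\mathbb{Z}$ with $f(\emptyset)=0$; its integral base polyhedron is $\mathcal{B}_f=\{y\in\mathbb{Z}^m:y(U)\le f(U)\ \forall U\subseteq E,\ y(E)=f(E)\}$ with $y(U)=\sum_{j\in U}y_j$. $X=\prod_iX_i$ and $\ell(x)=\sum_{i\in N}x_i$. The cost of player $i$ at $x\in X$ is $\pi_i(\ell(x),x_i)=\sum_{j\in E}c_{ij}(\ell_j(x))x_{ij}$ with each $c_{ij}:\mathbb{R}_+\to\mathbb{R}$ nondecreasing. Enforceability (atomic game). $u$ is enforceable if there are $\lambda\in\mathbb{R}^m_+$ and $x^*\in X$ with $\ell(x^* )=u$ and $x_i^*\in\arg\min_{x_i\in X_i}\{\pi_i(\ell(x_i,x_{-i}^* ),x_i)+\lambda^\intercal x_i\}$ for all $i\in N$, where $(x_i,x^*_{-i})$ is $x^*$ with player $i$'s strategy replaced by $x_i$. Minimality. $u$ is minimal for $X$ if there are strictly increasing $h_j:\mathbb{R}\to\mathbb{R}$ ($j\in E$) with $u\in\arg\min_{u'\in\mathbb{R}^m}\{\sum_{j\in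 E}h_j(u'_j):\exists x\in X\text{ with }\ell(x)\le u'\}$. *)

theory Defs
  imports "HOL-Analysis.Finite_Cartesian_Product"
begin

text \<open>
  The resources \<open>E\<close> and the players \<open>N\<close> are the elements of two finite (hence nonempty) types
  \<open>'e\<close> and \<open>'n\<close>. Vectors in $\mathbb{Z}^m$ and $\mathbb{R}^m$ have types \<open>int ^ 'e\<close> and \<open>real ^ 'e\<close>.
\<close>

definition integral_polymatroid_rank :: "('e::finite set \<Rightarrow> int) \<Rightarrow> bool" where
  "integral_polymatroid_rank f \<longleftrightarrow>
     (\<forall>U V. f (U \<union> V) + f (U \<inter> V) \<le> f U + f V) \<and> mono f \<and> f {} = 0"

definition integral_base_polyhedron :: "('e::finite set \<Rightarrow> int) \<Rightarrow> (int ^ 'e) set" where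
  "integral_base_polyhedron f =
     {y. (\<forall>U. (\<Sum>j\<in>U. y $ j) \<le> f U) \<and> (\<Sum>j\<in>UNIV. y $ j) = f UNIV}"

definition profiles :: "('n::finite \<Rightarrow> (int ^ 'e::finite) set) \<Rightarrow> ('n \<Rightarrow> int ^ 'e) set" where
  "profiles X = {x. \<forall>i. x i \<in> X i}"

definition load :: "('n::finite \<Rightarrow> int ^ 'e::finite) \<Rightarrow> int ^ 'e" where
  "load x = (\<Sum>i\<in>UNIV. x i)"

definition real_vec :: "int ^ 'e::finite \<Rightarrow> real ^ 'e" where
  "real_vec y = (\<chi> j. real_of_int (y $ j))"

text \<open>
  Cost functions have domain $\mathbb{R}_+$; they are represented by total functions whose values at
  negative arguments are unconstrained and never used when all strategies are nonnegative.
\<close>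

definition player_cost ::
    "('n::finite \<Rightarrow> 'e::finite \<Rightarrow> real \<Rightarrow> real) \<Rightarrow> 'n \<Rightarrow> int ^ 'e \<Rightarrow> int ^ 'e \<Rightarrow> real" where
  "player_cost c i l y = (\<Sum>j\<in>UNIV. c i j (real_vec l $ j) * real_vec y $ j)"

text \<open>
  The game is atomic: a deviating player changes the load, so the deviation cost is evaluated at
  the load of \<open>x(i := y)\<close>.
\<close>

definition enforceable ::
    "('n::finite \<Rightarrow> (int ^ 'e::finite) set) \<Rightarrow> ('n \<Rightarrow> 'e \<Rightarrow> real \<Rightarrow> real) \<Rightarrow> int ^ 'e \<Rightarrow> bool" where
  "enforceable X c u \<longleftrightarrow>
     (\<exists>(p :: real ^ 'e) x. (\<forall>j. 0 \<le> p $ j) \<and> x \<in> profiles X \<and> load x = u \<and>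
        (\<forall>i. is_arg_min
               (\<lambda>y. player_cost c i (load (x(i := y))) y + (\<Sum>j\<in>UNIV. p $ j * real_vec y $ j))
               (\<lambda>y. y \<in> X i) (x i)))"

text \<open>The comparison vectors \<open>v\<close> range over all of $\mathbb{R}^m$, not only over integral ones.\<close>

definition minimal_for ::
    "('n::finite \<Rightarrow> (int ^ 'e::finite) set) \<Rightarrow> int ^ 'e \<Rightarrow> bool" where
  "minimal_for X u \<longleftrightarrow>
     (\<exists>h :: 'e \<Rightarrow> real \<Rightarrow> real. (\<forall>j. strict_mono (h j)) \<and>
        is_arg_min (\<lambda>v :: real ^ 'e. \<Sum>j\<in>UNIV. h j (v $ j))
          (\<lambda>v. \<exists>x\<in>profiles X. \<forall>j. real_vec (load x) $ j \<le> v $ j) (real_vec u))"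

end

theory Submission imports Defs begin

text \<open>
  In a 0/1 strategy space a deviation replaces the cost of a resource \<open>j\<close> that is newly used by
  $c_{ij}(u_j+1) \ge c_{ij}(u_j)$, so it suffices to enforce \<open>u\<close> for the fixed weights
  $w_{ij} = c_{ij}(u_j)$. A minimal \<open>u\<close> is a load; take a profile with load \<open>u\<close> of least total weight. On the resources, draw an
  arc from \<open>a\<close> to \<open>b\<close> if some player \<open>i\<close> can exchange \<open>a\<close> for \<open>b\<close>, with length the least such
  $w_{ib} - w_{ia}$. A potential for these lengths gives the prices, since optimality against single
  exchanges implies optimality over the base polyhedron. Otherwise let $\mu < 0$ be the minimum mean
  of a cycle, take a potential for the lengths minus $\mu$, and consider a shortest cycle of tight
  arcs. It has no tight chords, so for each player the exchanges along it are triangular when ordered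
  by reduced weight and can be performed simultaneously; this keeps the load and lowers the total
  weight, a contradiction.
\<close>

section \<open>Potentials and minimum mean cycles\<close>

fun walk_cost :: "('a \<Rightarrow> 'a \<Rightarrow> real) \<Rightarrow> 'a list \<Rightarrow> real" where
  "walk_cost l [] = 0"
| "walk_cost l [x] = 0"
| "walk_cost l (x # y # zs) = l x y + walk_cost l (y # zs)"

lemma walk_cost_append:
  "walk_cost l (p @ y # r) = walk_cost l (p @ [y]) + walk_cost l (y # r)"
proof (induction p)
  case (Cons a p)
  then show ?case by (cases p) auto
qed simp

lemma walk_cost_eq_sum: "walk_cost l xs = (\<Sum>k<length xs - 1. l (xs ! k) (xs ! Suc k))"
proof (induction l xs rule: walk_cost.induct)
  case (3 l x y zs)
  then show ?case by (simp add: lessThan_Suc_eq_insert_0 sum.reindex zero_notin_Suc_image del: sum.lessThan_Suc)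
qed auto

text \<open>A list of length \<open>n\<close> has \<open>n - 1\<close> arcs. Subtracting
  \<open>\<mu>\<close> from every arc thus compares the mean arc length of a walk with
  \<open>\<mu>\<close>.\<close>

lemma walk_cost_shift:
  "xs \<noteq> [] \<Longrightarrow> walk_cost (\<lambda>a b. l a b - \<mu>) xs = walk_cost l xs - \<mu> * (real (length xs) - 1)"
  by (induction l xs rule: walk_cost.induct) (auto simp: algebra_simps)

text \<open>The first vertex is repeated at the end. The length bound makes the set finite, so that
  a minimum mean exists, yet admits every simple cycle; inner repetitions are allowed.\<close>

definition closed_walks :: "('a::finite \<Rightarrow> 'a \<Rightarrow> bool) \<Rightarrow> 'a list set" where
  "closed_walks R = {xs. 2 \<le> length xs \<and> length xs \<le> Suc CARD('a) \<and> successively R xs \<and> hd xs = last xs}"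

lemma finite_closed_walks: "finite (closed_walks R)" for R :: "'a::finite \<Rightarrow> 'a \<Rightarrow> bool"
  by (rule finite_subset[OF _ finite_lists_length_le[of UNIV "Suc CARD('a)"]])
     (auto simp: closed_walks_def)

text \<open>A repeated vertex encloses a closed walk, which is short enough to fall under
  \<open>nonneg\<close>. Cutting it out does not raise the cost. One cut suffices, since the length
  exceeds the target by at most one.\<close>

lemma shorten_walk:
  fixes R :: "'a::finite \<Rightarrow> 'a \<Rightarrow> bool"
  assumes nonneg: "\<And>xs. xs \<in> closed_walks R \<Longrightarrow> 0 \<le> walk_cost l xs"
    and xs: "successively R xs" "xs \<noteq> []" "length xs \<le> Suc CARD('a)"
  shows "\<exists>ys. successively R ys \<and> ys \<noteq> [] \<and> last ys = last xs \<and> length ys \<le> CARD('a) \<and>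
    walk_cost l ys \<le> walk_cost l xs"
proof (cases "distinct xs")
  case True
  then have "length xs \<le> CARD('a)"
    by (metis card_mono distinct_card finite top_greatest)
  with xs show ?thesis by blast
next
  case False
  then obtain p y q r where split: "xs = p @ [y] @ q @ [y] @ r"
    using not_distinct_decomp by blast
  have "xs = p @ (y # q @ [y]) @ r" "xs = (p @ y # q) @ (y # r)" "xs = p @ (y # q @ y # r)"
    by (simp_all add: split)
  then have succ: "successively R (y # q @ [y])" "successively R (p @ y # r)"
    using xs(1) by (metis successively_append_iff, metis list.distinct(1) list.sel(1) successively_append_iff)
  have "y # q @ [y] \<in> closed_walks R"
    using succ xs(3) by (auto simp: closed_walks_def split)
  then have "0 \<le> walk_cost l (y # q @ [y])"
    by (rule nonneg)
  moreover have "walk_cost l xs = walk_cost l (p @ [y]) + walk_cost l (y # q @ [y]) + walk_cost l (y # r)"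
    using walk_cost_append[of l p y "q @ y # r"] walk_cost_append[of l "y # q" y r]
    by (simp add: split)
  moreover have "walk_cost l (p @ y # r) = walk_cost l (p @ [y]) + walk_cost l (y # r)"
    by (rule walk_cost_append)
  ultimately have "walk_cost l (p @ y # r) \<le> walk_cost l xs"
    by linarith
  moreover have "last (p @ y # r) = last xs" "length (p @ y # r) \<le> CARD('a)"
    using xs(3) by (auto simp: split)
  ultimately show ?thesis
    using succ(2) by (intro exI[of _ "p @ y # r"]) auto
qed

text \<open>Shortest walk distances, with the starting vertex left free: \<open>d b\<close> is the
  least cost of a walk of at most \<open>CARD('a)\<close> vertices ending at \<open>b\<close>.
  Appending an arc to an optimal walk and shortening the result gives the inequality.\<close>

lemma potential_exists:
  fixes R :: "'a::finite \<Rightarrow> 'a \<Rightarrow> bool"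
  assumes nonneg: "\<And>xs. xs \<in> closed_walks R \<Longrightarrow> 0 \<le> walk_cost l xs"
  shows "\<exists>d. \<forall>a b. R a b \<longrightarrow> d b \<le> d a + l a b"
proof -
  define W where "W b = {xs. successively R xs \<and> xs \<noteq> [] \<and> last xs = b \<and> length xs \<le> CARD('a)}" for b
  have fin: "finite (W b)" for b
    by (rule finite_subset[OF _ finite_lists_length_le[of UNIV "CARD('a)"]]) (auto simp: W_def)
  have ne: "W b \<noteq> {}" for b
  proof -
    have "[b] \<in> W b" by (auto simp: W_def Suc_le_eq)
    then show ?thesis by blast
  qed
  define d where "d b = Min (walk_cost l ` W b)" for b
  have "d b \<le> d a + l a b" if "R a b" for a b
  proof -
    have "d a \<in> walk_cost l ` W a"
      unfolding d_def using fin ne by (intro Min_in) auto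
    then obtain xs where xs: "xs \<in> W a" "d a = walk_cost l xs" by blast
    then obtain p where p: "xs = p @ [a]"
      using that[of "butlast xs"] by (auto simp: W_def)
    have "successively R (xs @ [b])" "length (xs @ [b]) \<le> Suc CARD('a)"
      using xs(1) that by (auto simp: W_def successively_append_iff)
    from shorten_walk[OF nonneg this(1) _ this(2)] obtain ys
      where ys: "ys \<in> W b" "walk_cost l ys \<le> walk_cost l (xs @ [b])"
      by (auto simp: W_def)
    have "walk_cost l (xs @ [b]) = walk_cost l xs + l a b"
      using walk_cost_append[of l p a "[b]"] by (simp add: p)
    moreover have "d b \<le> walk_cost l ys"
      unfolding d_def using ys(1) fin by (intro Min_le) auto
    ultimately show ?thesis using ys(2) xs(2) by simp
  qed
  then show ?thesis by blast
qed

lemma potential_or_negative_tight_cycle: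
  fixes R :: "'a::finite \<Rightarrow> 'a \<Rightarrow> bool" and l :: "'a \<Rightarrow> 'a \<Rightarrow> real"
  obtains (potential) d where "\<And>a b. R a b \<Longrightarrow> d b \<le> d a + l a b"
  | (cycle) \<mu> d n s where "\<mu> < 0" "\<And>a b. R a b \<Longrightarrow> d b \<le> d a + l a b - \<mu>"
      "0 < n" "s n = s (0::nat)"
      "\<And>k. k < n \<Longrightarrow> R (s k) (s (Suc k)) \<and> d (s (Suc k)) = d (s k) + l (s k) (s (Suc k)) - \<mu>"
proof (cases "\<forall>xs\<in>closed_walks R. 0 \<le> walk_cost l xs")
  case True
  then show ?thesis using potential_exists[of R l] potential by blast
next
  case False
  then have ne: "closed_walks R \<noteq> {}" by blast
  define mean where "mean xs = walk_cost l xs / (real (length xs) - 1)" for xs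
  define \<mu> where "\<mu> = Min (mean ` closed_walks R)"
  have len: "1 < length xs" "xs \<noteq> []" if "xs \<in> closed_walks R" for xs
    using that by (auto simp: closed_walks_def)
  have le: "\<mu> \<le> mean xs" if "xs \<in> closed_walks R" for xs
    unfolding \<mu>_def using that finite_closed_walks by (intro Min_le) auto
  have "\<mu> \<in> mean ` closed_walks R"
    unfolding \<mu>_def using ne finite_closed_walks by (intro Min_in) auto
  then obtain xs where xs: "xs \<in> closed_walks R" "\<mu> = mean xs" by blast
  obtain zs where zs: "zs \<in> closed_walks R" "walk_cost l zs < 0"
    using False by force
  have "mean zs < 0"
    unfolding mean_def using zs len[OF zs(1)] by (auto simp: divide_neg_pos)
  with le[OF zs(1)] have neg: "\<mu> < 0" by linarith
  \<comment> \<open>No closed walk has mean below \<open>\<mu>\<close>, so the shifted lengths admit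
    a potential.\<close>
  have "0 \<le> walk_cost (\<lambda>a b. l a b - \<mu>) ys" if "ys \<in> closed_walks R" for ys
    using le[OF that] len[OF that] by (simp add: walk_cost_shift mean_def field_simps)
  from potential_exists[OF this] obtain d where d: "R a b \<Longrightarrow> d b \<le> d a + (l a b - \<mu>)" for a b
    by blast
  define n where "n = length xs - 1"
  have n: "0 < n" "length xs = Suc n"
    using len[OF xs(1)] by (auto simp: n_def)
  have ends: "xs ! n = xs ! 0"
    using xs(1) len[OF xs(1)] by (simp add: closed_walks_def n_def hd_conv_nth last_conv_nth)
  have arcs: "R (xs ! k) (xs ! Suc k)" if "k < n" for k
    using xs(1) that n by (simp add: closed_walks_def successively_conv_nth)
  define slack where "slack k = d (xs ! k) + (l (xs ! k) (xs ! Suc k) - \<mu>) - d (xs ! Suc k)" for k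
  have slack_nonneg: "0 \<le> slack k" if "k < n" for k
    using d[OF arcs[OF that]] by (simp add: slack_def)
  \<comment> \<open>Around the minimising walk the potential differences telescope to zero and the
    shifted cost is zero, so the nonnegative slacks all vanish.\<close>
  have "(\<Sum>k<n. slack k) = walk_cost (\<lambda>a b. l a b - \<mu>) xs - (\<Sum>k<n. d (xs ! Suc k) - d (xs ! k))"
    unfolding walk_cost_eq_sum slack_def n by (simp add: sum.distrib sum_subtractf)
  also have "(\<Sum>k<n. d (xs ! Suc k) - d (xs ! k)) = 0"
    using sum_lessThan_telescope[of "\<lambda>k. d (xs ! k)" n] ends by simp
  also have "walk_cost (\<lambda>a b. l a b - \<mu>) xs = 0"
    using xs(2) len[OF xs(1)] by (simp add: walk_cost_shift mean_def field_simps)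
  finally have "(\<Sum>k<n. slack k) = 0" by simp
  then have tight: "slack k = 0" if "k < n" for k
    using that slack_nonneg sum_nonneg_eq_0_iff[of "{..<n}" slack] by auto
  show ?thesis
  proof (rule cycle[of \<mu> d n "\<lambda>k. xs ! k"])
    show "d b \<le> d a + l a b - \<mu>" if "R a b" for a b
      using d[OF that] by simp
    show "R (xs ! k) (xs ! Suc k) \<and>
        d (xs ! Suc k) = d (xs ! k) + l (xs ! k) (xs ! Suc k) - \<mu>" if "k < n" for k
      using arcs[OF that] tight[OF that] by (simp add: slack_def)
  qed (use neg n ends in auto)
qed

text \<open>In a closed sequence with the fewest arcs, any chord would close up a shorter
  one.\<close>

lemma chordless_cycle:
  fixes T :: "'a \<Rightarrow> 'a \<Rightarrow> bool" and s :: "nat \<Rightarrow> 'a"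
  assumes "0 < n" "s n = s 0" "\<And>k. k < n \<Longrightarrow> T (s k) (s (Suc k))"
  obtains m t where "0 < m" "t m = t (0::nat)" "\<And>k. k < m \<Longrightarrow> T (t k) (t (Suc k))"
    "\<And>j k. j < m \<Longrightarrow> k < m \<Longrightarrow> T (t j) (t (Suc k)) \<Longrightarrow> j = k"
proof -
  define P where "P m \<longleftrightarrow> 0 < m \<and> (\<exists>t. t m = t (0::nat) \<and> (\<forall>k<m. T (t k) (t (Suc k))))" for m
  define m where "m = (LEAST m. P m)"
  have "P n" using assms by (auto simp: P_def)
  then have "P m" unfolding m_def by (rule LeastI)
  then obtain t where t: "0 < m" "t m = t 0" "\<And>k. k < m \<Longrightarrow> T (t k) (t (Suc k))"
    by (auto simp: P_def)
  have shortest: "\<not> P m'" if "m' < m" for m'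
    using that not_less_Least unfolding m_def by blast
  have "j = k" if jk: "j < m" "k < m" and chord: "T (t j) (t (Suc k))" for j k
  proof (rule ccontr)
    assume "j \<noteq> k"
    then consider "k < j" | "j < k" by linarith
    then show False
    proof cases
      case 1
      \<comment> \<open>A backward chord closes the segment from \<open>t (Suc k)\<close> to
        \<open>t j\<close>; the last index of \<open>r\<close> repeats
        \<open>t (Suc k)\<close>.\<close>
      define r where "r i = (if i = j - k then t (Suc k) else t (Suc k + i))" for i
      have "T (r i) (r (Suc i))" if "i < j - k" for i
      proof (cases "Suc i = j - k")
        case True
        then have "j = Suc (k + i)" by simp
        then show ?thesis using chord True by (simp add: r_def)
      next
        case False
        then show ?thesis using that jk t(3)[of "Suc k + i"] by (simp add: r_def)
      qed
      moreover have "r (j - k) = r 0" by (simp add: r_def)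
      ultimately have "P (j - k)" using 1 by (auto simp: P_def)
      then show False using shortest[of "j - k"] 1 jk by simp
    next
      case 2
      \<comment> \<open>A forward chord jumps from \<open>t j\<close> straight to
        \<open>t (Suc k)\<close>, which saves \<open>k - j\<close> arcs.\<close>
      define r where "r i = (if i \<le> j then t i else t (i + (k - j)))" for i
      have "T (r i) (r (Suc i))" if "i < m - (k - j)" for i
      proof (cases i j rule: linorder_cases)
        case less
        then show ?thesis using jk t(3)[of i] by (simp add: r_def)
      next
        case equal
        then show ?thesis using chord 2 by (simp add: r_def)
      next
        case greater
        then show ?thesis using that 2 t(3)[of "i + (k - j)"] by (simp add: r_def)
      qed
      moreover have "r (m - (k - j)) = r 0" using 2 jk t(2) by (simp add: r_def)
      moreover have "0 < m - (k - j)" "m - (k - j) < m" using 2 jk by auto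
      ultimately have "P (m - (k - j))" unfolding P_def by blast
      then show False using shortest[of "m - (k - j)"] \<open>m - (k - j) < m\<close> by blast
    qed
  qed
  with t show ?thesis using that by blast
qed

section \<open>Exchanges in integral base polyhedra\<close>

definition slack :: "('e::finite set \<Rightarrow> int) \<Rightarrow> int ^ 'e \<Rightarrow> 'e set \<Rightarrow> int" where
  "slack f x U = f U - (\<Sum>j\<in>U. x $ j)"

text \<open>For \<open>x\<close> in the base polyhedron and \<open>a \<noteq> b\<close>, integrality
  makes this equivalent to \<open>x + axis b 1 - axis a 1\<close> staying in it. For
  \<open>a = b\<close> it holds vacuously.\<close>

definition exchangeable :: "('e::finite set \<Rightarrow> int) \<Rightarrow> int ^ 'e \<Rightarrow> 'e \<Rightarrow> 'e \<Rightarrow> bool" where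
  "exchangeable f x a b \<longleftrightarrow> (\<forall>U. b \<in> U \<longrightarrow> a \<notin> U \<longrightarrow> 0 < slack f x U)"

lemma slack_nonneg: "x \<in> integral_base_polyhedron f \<Longrightarrow> 0 \<le> slack f x U"
  by (simp add: integral_base_polyhedron_def slack_def)

lemma slack_UNIV: "x \<in> integral_base_polyhedron f \<Longrightarrow> slack f x UNIV = 0"
  by (simp add: integral_base_polyhedron_def slack_def)

lemma slack_empty: "integral_polymatroid_rank f \<Longrightarrow> slack f x {} = 0"
  by (simp add: integral_polymatroid_rank_def slack_def)

lemma slack_submodular:
  assumes "integral_polymatroid_rank f"
  shows "slack f x (U \<union> V) + slack f x (U \<inter> V) \<le> slack f x U + slack f x V"
proof -
  have "f (U \<union> V) + f (U \<inter> V) \<le> f U + f V"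
    using assms by (simp add: integral_polymatroid_rank_def)
  moreover have "(\<Sum>j\<in>U \<union> V. x $ j) + (\<Sum>j\<in>U \<inter> V. x $ j) = (\<Sum>j\<in>U. x $ j) + (\<Sum>j\<in>V. x $ j)"
    by (rule sum.union_inter) auto
  ultimately show ?thesis by (simp add: slack_def)
qed

context
  fixes f :: "'e::finite set \<Rightarrow> int" and x :: "int ^ 'e"
  assumes rank: "integral_polymatroid_rank f" and base: "x \<in> integral_base_polyhedron f"
begin

lemma tight_Un: "slack f x U = 0 \<Longrightarrow> slack f x V = 0 \<Longrightarrow> slack f x (U \<union> V) = 0"
  and tight_Int: "slack f x U = 0 \<Longrightarrow> slack f x V = 0 \<Longrightarrow> slack f x (U \<inter> V) = 0"
  using slack_submodular[OF rank, of x U V] slack_nonneg[OF base, of "U \<union> V"]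
    slack_nonneg[OF base, of "U \<inter> V"] by simp_all

text \<open>Each forbidden exchange is blocked by a tight set containing \<open>b\<close> but not
  \<open>a\<close>; tight sets are closed under intersection.\<close>

lemma tight_set_avoiding:
  assumes "\<And>a. a \<in> A \<Longrightarrow> \<not> exchangeable f x a b"
  shows "\<exists>T. slack f x T = 0 \<and> b \<in> T \<and> T \<inter> A = {}"
  using finite[of A] assms
proof (induction A rule: finite_induct)
  case empty
  then show ?case using slack_UNIV[OF base] by blast
next
  case (insert a A)
  then obtain T where T: "slack f x T = 0" "b \<in> T" "T \<inter> A = {}" by blast
  from insert have "\<not> exchangeable f x a b" by blast
  then obtain V where V: "b \<in> V" "a \<notin> V" "slack f x V = 0"
    using slack_nonneg[OF base] by (auto simp: exchangeable_def order_less_le)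
  have "slack f x (T \<inter> V) = 0" using T V by (intro tight_Int)
  then show ?case using T V by (intro exI[of _ "T \<inter> V"]) auto
qed

text \<open>The set is the union over its elements of tight sets separating each of them from the
  complement.\<close>

lemma tight_if_no_exchange_into:
  assumes "\<And>a b. b \<in> L \<Longrightarrow> a \<notin> L \<Longrightarrow> \<not> exchangeable f x a b"
  shows "slack f x L = 0"
proof -
  have "\<exists>T. slack f x T = 0 \<and> M \<subseteq> T \<and> T \<subseteq> L" if "M \<subseteq> L" for M
    using finite[of M] that
  proof (induction M rule: finite_induct)
    case empty
    then show ?case using slack_empty[OF rank] by blast
  next
    case (insert b M)
    then obtain T where T: "slack f x T = 0" "M \<subseteq> T" "T \<subseteq> L" by blast
    obtain V where V: "slack f x V = 0" "b \<in> V" "V \<inter> - L = {}"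
      using tight_set_avoiding[of "- L" b] assms insert by blast
    have "slack f x (T \<union> V) = 0" using T V by (intro tight_Un)
    then show ?case using T V by (intro exI[of _ "T \<union> V"]) auto
  qed
  from this[of L] show ?thesis by auto
qed

text \<open>The hypothesis on \<open>v\<close> makes the exchange relation between the \<open>a k\<close> and the \<open>b l\<close>
  triangular when the pairs are ordered by \<open>v\<close>. The pair with least \<open>v\<close> can then be uncrossed with a tight set that
  leaves all other pairs violated.\<close>

lemma card_le_slack:
  fixes v :: "'k \<Rightarrow> real"
  assumes "finite K"
    and "\<And>k. k \<in> K \<Longrightarrow> exchangeable f x (a k) (b k)"
    and "\<And>k l. k \<in> K \<Longrightarrow> l \<in> K \<Longrightarrow> v l \<le> v k \<Longrightarrow> exchangeable f x (a k) (b l) \<Longrightarrow> k = l"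
    and "\<And>k. k \<in> K \<Longrightarrow> b k \<in> U \<and> a k \<notin> U"
  shows "int (card K) \<le> slack f x U"
  using assms
proof (induction "card K" arbitrary: K U)
  case 0
  then show ?case using slack_nonneg[OF base] by simp
next
  case (Suc n)
  then have "K \<noteq> {}" by auto
  then obtain l where l: "l \<in> K" "\<And>k. k \<in> K \<Longrightarrow> v l \<le> v k"
    using ex_min_if_finite[of "v ` K"] Suc.prems(1) by (force simp: not_less)
  have "\<not> exchangeable f x (a k) (b l)" if "k \<in> K - {l}" for k
    using Suc.prems(3)[of k l] l that by auto
  then obtain T where T: "slack f x T = 0" "b l \<in> T" "T \<inter> a ` (K - {l}) = {}"
    using tight_set_avoiding[of "a ` (K - {l})" "b l"] by blast
  have "int (card (K - {l})) \<le> slack f x (U \<union> T)"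
  proof (rule Suc.hyps(1))
    show "n = card (K - {l})" using Suc.hyps(2) Suc.prems(1) l(1) by simp
    show "b k \<in> U \<union> T \<and> a k \<notin> U \<union> T" if "k \<in> K - {l}" for k
      using that Suc.prems(4) T(3) by blast
  qed (use Suc.prems in auto)
  \<comment> \<open>This set contains \<open>b l\<close> but not \<open>a l\<close>, so it supplies
    the one unit of slack that the induction hypothesis for \<open>U \<union> T\<close>
    lacks.\<close>
  moreover have "0 < slack f x (U \<inter> T)"
    using Suc.prems(2,4)[OF l(1)] T(2) by (auto simp: exchangeable_def)
  moreover have "slack f x (U \<union> T) + slack f x (U \<inter> T) \<le> slack f x U + slack f x T"
    by (rule slack_submodular[OF rank])
  moreover have "int (card K) = int (card (K - {l})) + 1"
    using Suc.prems(1) l(1) card_Suc_Diff1[of K l] by linarith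
  ultimately show ?case using T(1) by linarith
qed

text \<open>The sum over a set \<open>U\<close> grows at most by the number of pairs with
  \<open>b k\<close> inside and \<open>a k\<close> outside, and \<open>card_le_slack\<close> bounds
  that number by the slack of \<open>U\<close>.\<close>

lemma simultaneous_exchange:
  fixes v :: "'k \<Rightarrow> real"
  assumes "finite K"
    and "\<And>k. k \<in> K \<Longrightarrow> exchangeable f x (a k) (b k)"
    and "\<And>k l. k \<in> K \<Longrightarrow> l \<in> K \<Longrightarrow> v l \<le> v k \<Longrightarrow> exchangeable f x (a k) (b l) \<Longrightarrow> k = l"
  shows "x + (\<Sum>k\<in>K. axis (b k) 1 - axis (a k) 1) \<in> integral_base_polyhedron f"
proof -
  let ?y = "x + (\<Sum>k\<in>K. axis (b k) 1 - axis (a k) 1)"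
  have sum_y: "(\<Sum>j\<in>U. ?y $ j) =
      (\<Sum>j\<in>U. x $ j) + (\<Sum>k\<in>K. of_bool (b k \<in> U) - of_bool (a k \<in> U))" for U
  proof -
    have "(\<Sum>j\<in>U. ?y $ j) = (\<Sum>j\<in>U. x $ j) + (\<Sum>k\<in>K. \<Sum>j\<in>U. axis (b k) 1 $ j - axis (a k) 1 $ j)"
      by (simp add: sum.distrib sum.swap[of _ K U])
    also have "(\<Sum>j\<in>U. axis c 1 $ j) = (of_bool (c \<in> U) :: int)" for c
      by (simp add: axis_def of_bool_def)
    then have "(\<Sum>k\<in>K. \<Sum>j\<in>U. axis (b k) 1 $ j - axis (a k) 1 $ j) =
        (\<Sum>k\<in>K. of_bool (b k \<in> U) - of_bool (a k \<in> U) :: int)"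
      by (simp add: sum_subtractf)
    finally show ?thesis .
  qed
  have "(\<Sum>j\<in>U. ?y $ j) \<le> f U" for U
  proof -
    let ?K = "{k \<in> K. b k \<in> U \<and> a k \<notin> U}"
    have "(\<Sum>k\<in>K. of_bool (b k \<in> U) - of_bool (a k \<in> U) :: int) \<le> (\<Sum>k\<in>K. of_bool (b k \<in> U \<and> a k \<notin> U))"
      by (intro sum_mono) auto
    also have "\<dots> = int (card ?K)"
      using assms(1) by (simp add: Int_def)
    also have "\<dots> \<le> slack f x U"
      using assms by (intro card_le_slack[where a = a and b = b and v = v]) auto
    finally show ?thesis unfolding sum_y by (simp add: slack_def)
  qed
  moreover have "(\<Sum>j\<in>UNIV. ?y $ j) = f UNIV"
    using slack_UNIV[OF base] unfolding sum_y by (simp add: slack_def)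
  ultimately show ?thesis by (simp add: integral_base_polyhedron_def)
qed

end

text \<open>Abel summation over the values of \<open>v\<close>.\<close>

lemma weighted_sum_nonneg_of_lower_sets:
  fixes v d :: "'e::finite \<Rightarrow> real"
  assumes lower: "\<And>L. (\<And>j k. j \<in> L \<Longrightarrow> v k \<le> v j \<Longrightarrow> k \<in> L) \<Longrightarrow> (\<Sum>j\<in>L. d j) \<le> 0"
    and total: "(\<Sum>j\<in>UNIV. d j) = 0"
  shows "0 \<le> (\<Sum>j\<in>UNIV. v j * d j)"
proof -
  \<comment> \<open>Generalised to lower sets \<open>S\<close> and upper bounds \<open>t\<close> of
    \<open>v\<close> on \<open>S\<close>, so that the top level of \<open>v\<close> can be peeled
    off.\<close>
  have "0 \<le> (\<Sum>j\<in>S. (v j - t) * d j)"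
    if "\<And>j k. j \<in> S \<Longrightarrow> v k \<le> v j \<Longrightarrow> k \<in> S" "\<And>j. j \<in> S \<Longrightarrow> v j \<le> t" for S t
    using that
  proof (induction "card S" arbitrary: S t rule: less_induct)
    case less
    show ?case
    proof (cases "S = {}")
      case False
      define m where "m = Max (v ` S)"
      have m: "v j \<le> m" if "j \<in> S" for j
        unfolding m_def using that by simp
      have "m \<in> v ` S" unfolding m_def using False by (intro Max_in) auto
      then obtain z where z: "z \<in> S" "v z = m" by blast
      let ?S = "{j \<in> S. v j < m}"
      have "?S \<subset> S" using z by auto
      then have "card ?S < card S" by (simp add: psubset_card_mono)
      then have "0 \<le> (\<Sum>j\<in>?S. (v j - m) * d j)"
        by (rule less.hyps) (use less.prems(1) in auto)
      \<comment> \<open>The peeled elements have \<open>v j = m\<close> and contribute nothing.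
        Passing from \<open>m\<close> to \<open>t\<close> then costs a product of two nonpositive
        factors.\<close>
      also have "\<dots> = (\<Sum>j\<in>S. (v j - m) * d j)"
        using m by (intro sum.mono_neutral_left) (auto simp: order_less_le)
      also have "\<dots> = (\<Sum>j\<in>S. (v j - t) * d j) - (m - t) * (\<Sum>j\<in>S. d j)"
        by (simp add: sum_distrib_left flip: sum_subtractf) (simp add: algebra_simps)
      finally have "(m - t) * (\<Sum>j\<in>S. d j) \<le> (\<Sum>j\<in>S. (v j - t) * d j)" by simp
      moreover have "0 \<le> (m - t) * (\<Sum>j\<in>S. d j)"
        using z less.prems lower[of S] by (intro mult_nonpos_nonpos) auto
      ultimately show ?thesis by linarith
    qed simp
  qed
  from this[of UNIV "Max (range v)"] have "0 \<le> (\<Sum>j\<in>UNIV. (v j - Max (range v)) * d j)"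
    by simp
  also have "\<dots> = (\<Sum>j\<in>UNIV. v j * d j) - Max (range v) * (\<Sum>j\<in>UNIV. d j)"
    by (simp add: sum_distrib_left left_diff_distrib sum_subtractf)
  finally show ?thesis by (simp add: total)
qed

text \<open>No exchange enters a lower set \<open>L\<close> of \<open>v\<close> from outside, so
  \<open>L\<close> is tight for \<open>x\<close>, and \<open>y\<close> has at most the sum of
  \<open>x\<close> on \<open>L\<close>. Abel summation turns this into the inequality of weighted
  sums.\<close>

lemma base_optimal_if_exchange_optimal:
  fixes v :: "'e::finite \<Rightarrow> real"
  assumes rank: "integral_polymatroid_rank f"
    and base: "x \<in> integral_base_polyhedron f" "y \<in> integral_base_polyhedron f"
    and exch: "\<And>a b. exchangeable f x a b \<Longrightarrow> v a \<le> v b"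
  shows "(\<Sum>j\<in>UNIV. v j * real_of_int (x $ j)) \<le> (\<Sum>j\<in>UNIV. v j * real_of_int (y $ j))"
proof -
  have "0 \<le> (\<Sum>j\<in>UNIV. v j * real_of_int (y $ j - x $ j))"
  proof (rule weighted_sum_nonneg_of_lower_sets)
    fix L assume L: "\<And>j k. j \<in> L \<Longrightarrow> v k \<le> v j \<Longrightarrow> k \<in> L"
    have "slack f x L = 0"
      using exch L by (intro tight_if_no_exchange_into[OF rank base(1)]) blast
    with slack_nonneg[OF base(2), of L] have "(\<Sum>j\<in>L. y $ j - x $ j) \<le> 0"
      by (simp add: slack_def sum_subtractf)
    then show "(\<Sum>j\<in>L. real_of_int (y $ j - x $ j)) \<le> 0"
      unfolding of_int_sum[symmetric] by linarith
  next
    have "(\<Sum>j\<in>UNIV. y $ j - x $ j) = 0"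
      using base by (simp add: integral_base_polyhedron_def sum_subtractf)
    then show "(\<Sum>j\<in>UNIV. real_of_int (y $ j - x $ j)) = 0"
      unfolding of_int_sum[symmetric] by simp
  qed
  then show ?thesis by (simp add: algebra_simps sum_subtractf)
qed

section \<open>Prices for a cheapest profile\<close>

text \<open>The exchanges of all players are merged into one graph, so a single potential prices the
  resources for everybody.\<close>

lemma prices_for_cheapest_profile:
  fixes f :: "'n::finite \<Rightarrow> 'e::finite set \<Rightarrow> int" and w :: "'n \<Rightarrow> 'e \<Rightarrow> real"
  assumes rank: "\<And>i. integral_polymatroid_rank (f i)"
    and base: "\<And>i. x i \<in> integral_base_polyhedron (f i)"
    and cheapest: "\<And>x'. (\<And>i. x' i \<in> integral_base_polyhedron (f i)) \<Longrightarrow> load x' = load x \<Longrightarrow>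
      (\<Sum>i\<in>UNIV. \<Sum>j\<in>UNIV. w i j * x i $ j) \<le> (\<Sum>i\<in>UNIV. \<Sum>j\<in>UNIV. w i j * x' i $ j)"
  obtains p :: "'e \<Rightarrow> real"
  where "\<And>i a b. exchangeable (f i) (x i) a b \<Longrightarrow> w i a + p a \<le> w i b + p b"
proof -
  define R where "R a b \<longleftrightarrow> (\<exists>i. exchangeable (f i) (x i) a b)" for a b
  define l where "l a b = Min ((\<lambda>i. w i b - w i a) ` {i. exchangeable (f i) (x i) a b})" for a b
  have l_le: "l a b \<le> w i b - w i a" if "exchangeable (f i) (x i) a b" for i a b
    unfolding l_def using that by (intro Min_le) auto
  have "\<exists>i. exchangeable (f i) (x i) a b \<and> l a b = w i b - w i a" if "R a b" for a b
  proof -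
    have "l a b \<in> (\<lambda>i. w i b - w i a) ` {i. exchangeable (f i) (x i) a b}"
      unfolding l_def using that by (intro Min_in) (auto simp: R_def)
    then show ?thesis by blast
  qed
  then obtain g where g: "exchangeable (f (g a b)) (x (g a b)) a b"
    "l a b = w (g a b) b - w (g a b) a" if "R a b" for a b
    by metis
  from potential_or_negative_tight_cycle[of R l] show ?thesis
  proof cases
    case (potential d)
    show ?thesis
    \<comment> \<open>The prices are the negated potential; they may be negative at this
      stage.\<close>
    proof (rule that[of "\<lambda>j. - d j"])
      show "w i a + - d a \<le> w i b + - d b" if "exchangeable (f i) (x i) a b" for i a b
        proof -
        have "d b \<le> d a + l a b" using that by (intro potential) (auto simp: R_def)
        then show ?thesis using l_le[OF that] by simp
      qed
    qed
  next
    case (cycle \<mu> d n s)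
    define T where "T a b \<longleftrightarrow> R a b \<and> d b = d a + l a b - \<mu>" for a b
    obtain m t where t: "0 < m" "t m = t (0::nat)" "\<And>k. k < m \<Longrightarrow> T (t k) (t (Suc k))"
      and chordless: "\<And>j k. j < m \<Longrightarrow> k < m \<Longrightarrow> T (t j) (t (Suc k)) \<Longrightarrow> j = k"
      using chordless_cycle[of n s T] cycle by (auto simp: T_def)
    define i where "i k = g (t k) (t (Suc k))" for k
    have i: "exchangeable (f (i k)) (x (i k)) (t k) (t (Suc k))"
      "d (t (Suc k)) = d (t k) + (w (i k) (t (Suc k)) - w (i k) (t k)) - \<mu>" if "k < m" for k
      using t(3)[OF that] g unfolding i_def T_def by auto
    define e where "e k = axis (t (Suc k)) 1 - axis (t k) (1::int)" for k
    define x' where "x' q = x q + (\<Sum>k\<in>{k. k < m \<and> i k = q}. e k)" for q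
    have "x' q \<in> integral_base_polyhedron (f q)" for q
      unfolding x'_def e_def
    \<comment> \<open>Reduced weights give the triangular order: if \<open>t h\<close> has reduced
      weight at most that of \<open>t k\<close>, the potential inequality for an exchange of
      \<open>t k\<close> for \<open>t (Suc h)\<close> must be an equality. The arc is then tight,
      and chordlessness yields \<open>k = h\<close>.\<close>
    proof (rule simultaneous_exchange[OF rank base, where v = "\<lambda>k. w q (t k) - d (t k)"])
      fix k h
      assume kh: "k \<in> {k. k < m \<and> i k = q}" "h \<in> {k. k < m \<and> i k = q}"
        and le: "w q (t h) - d (t h) \<le> w q (t k) - d (t k)"
        and ex: "exchangeable (f q) (x q) (t k) (t (Suc h))"
      have "d (t (Suc h)) \<le> d (t k) + l (t k) (t (Suc h)) - \<mu>"
        using ex by (intro cycle(2)) (auto simp: R_def)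
      moreover have "l (t k) (t (Suc h)) \<le> w q (t (Suc h)) - w q (t k)"
        by (rule l_le[OF ex])
      moreover have "d (t (Suc h)) = d (t h) + (w q (t (Suc h)) - w q (t h)) - \<mu>"
        using i(2)[of h] kh by simp
      ultimately have "T (t k) (t (Suc h))"
        using le ex unfolding T_def R_def by force
      then show "k = h" using chordless[of k h] kh by simp
    qed (use i in auto)
    \<comment> \<open>Every arc of the cycle is assigned to exactly one player. The statement is
      polymorphic because it is applied both to vectors and to real weights.\<close>
    moreover have regroup: "(\<Sum>q\<in>UNIV. \<Sum>k\<in>{k. k < m \<and> i k = q}. F k) = (\<Sum>k<m. F k)"
      for F :: "nat \<Rightarrow> 'z::comm_monoid_add"
      using sum.group[of "{..<m}" UNIV i F] by (simp add: lessThan_def)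
    moreover have "load x' = load x"
    proof -
      have "load x' = load x + (\<Sum>k<m. e k)"
        unfolding load_def x'_def by (simp add: sum.distrib regroup)
      also have "(\<Sum>k<m. e k) = 0"
        using sum_lessThan_telescope[of "\<lambda>k. axis (t k) (1::int)" m] t(2) by (simp add: e_def)
      finally show ?thesis by simp
    qed
    ultimately have "(\<Sum>q\<in>UNIV. \<Sum>j\<in>UNIV. w q j * x q $ j) \<le> (\<Sum>q\<in>UNIV. \<Sum>j\<in>UNIV. w q j * x' q $ j)"
      by (intro cheapest)
    also have "\<dots> = (\<Sum>q\<in>UNIV. \<Sum>j\<in>UNIV. w q j * x q $ j) +
        (\<Sum>q\<in>UNIV. \<Sum>k\<in>{k. k < m \<and> i k = q}. w (i k) (t (Suc k)) - w (i k) (t k))"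
    proof -
      have w_e: "(\<Sum>j\<in>UNIV. w q j * (e k $ j)) = w q (t (Suc k)) - w q (t k)" for q k
      proof -
        have "w q j * (e k $ j) = (if j = t (Suc k) then w q j else 0) - (if j = t k then w q j else 0)" for j
          by (simp add: e_def axis_def)
        then show ?thesis by (simp add: sum_subtractf)
      qed
      have "(\<Sum>j\<in>UNIV. w q j * x' q $ j) = (\<Sum>j\<in>UNIV. w q j * x q $ j) +
        (\<Sum>k\<in>{k. k < m \<and> i k = q}. w (i k) (t (Suc k)) - w (i k) (t k))" for q
      proof -
        have "(\<Sum>j\<in>UNIV. w q j * x' q $ j) = (\<Sum>j\<in>UNIV. w q j * x q $ j) +
          (\<Sum>j\<in>UNIV. \<Sum>k\<in>{k. k < m \<and> i k = q}. w q j * (e k $ j))"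
          by (simp add: x'_def distrib_left sum.distrib sum_distrib_left)
        also have "(\<Sum>j\<in>UNIV. \<Sum>k\<in>{k. k < m \<and> i k = q}. w q j * (e k $ j)) =
          (\<Sum>k\<in>{k. k < m \<and> i k = q}. w (i k) (t (Suc k)) - w (i k) (t k))"
          by (subst sum.swap) (simp add: w_e)
        finally show ?thesis .
      qed
      then show ?thesis by (simp add: sum.distrib)
    qed
    \<comment> \<open>On a tight arc the weight change is the potential difference plus
      \<open>\<mu>\<close>; the differences telescope away, leaving a negative total.\<close>
    also have "(\<Sum>q\<in>UNIV. \<Sum>k\<in>{k. k < m \<and> i k = q}. w (i k) (t (Suc k)) - w (i k) (t k)) =
        (\<Sum>k<m. (d (t (Suc k)) - d (t k)) + \<mu>)"
      unfolding regroup using i(2) by (intro sum.cong) auto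
    also have "\<dots> = m * \<mu>"
      using sum_lessThan_telescope[of "\<lambda>k. d (t k)" m] t(2) by (simp add: sum.distrib)
    finally have "0 \<le> m * \<mu>" by simp
    then show ?thesis using cycle(1) t(1) by (simp add: zero_le_mult_iff)
  qed
qed

section \<open>From the congestion game to fixed weights\<close>

lemma finite_binary_profiles:
  fixes X :: "'n::finite \<Rightarrow> (int ^ 'e::finite) set"
  assumes "\<And>i. X i \<subseteq> {y. \<forall>j. y $ j \<in> {0, 1}}"
  shows "finite (profiles X)"
proof (rule finite_subset)
  \<comment> \<open>A binary profile is encoded by its set of player-resource pairs, and there are
    finitely many such sets.\<close>
  show "profiles X \<subseteq> range (\<lambda>S i. \<chi> j. of_bool ((i, j) \<in> S))"
  proof
    fix x assume "x \<in> profiles X"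
    then have "x i $ j \<in> {0, 1}" for i j
      using assms by (force simp: profiles_def)
    then have "x i $ j = of_bool ((i, j) \<in> {(i, j). x i $ j = 1})" for i j
      by force
    then have "x = (\<lambda>i. \<chi> j. of_bool ((i, j) \<in> {(i, j). x i $ j = 1}))"
      by (auto simp: vec_eq_iff fun_eq_iff)
    then show "x \<in> range (\<lambda>S i. \<chi> j. of_bool ((i, j) \<in> S))" by blast
  qed
qed simp

text \<open>A load dominated by \<open>u\<close> is itself an admissible comparison vector; were it
  smaller in one coordinate, the strictly increasing \<open>h\<close> would make its objective value
  smaller.\<close>

lemma minimal_for_imp_load:
  fixes X :: "'n::finite \<Rightarrow> (int ^ 'e::finite) set"
  assumes "minimal_for X u"
  obtains x where "x \<in> profiles X" "load x = u"
proof -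
  obtain h :: "'e \<Rightarrow> real \<Rightarrow> real" where h: "\<And>j. strict_mono (h j)"
    and min: "is_arg_min (\<lambda>v :: real ^ 'e. \<Sum>j\<in>UNIV. h j (v $ j))
      (\<lambda>v. \<exists>x\<in>profiles X. \<forall>j. real_vec (load x) $ j \<le> v $ j) (real_vec u)"
    using assms unfolding minimal_for_def by blast
  then obtain x where x: "x \<in> profiles X" "\<And>j. load x $ j \<le> u $ j"
    by (auto simp: is_arg_min_def real_vec_def)
  have "load x = u"
  proof (rule ccontr)
    assume "load x \<noteq> u"
    then obtain k where "load x $ k \<noteq> u $ k" by (auto simp: vec_eq_iff)
    with x(2)[of k] have "load x $ k < u $ k" by simp
    then have "h k (real_vec (load x) $ k) < h k (real_vec u $ k)"
      using strict_monoD[OF h] by (simp add: real_vec_def)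
    moreover have "h j (real_vec (load x) $ j) \<le> h j (real_vec u $ j)" for j
      using x(2) monoD[OF strict_mono_mono[OF h]] by (simp add: real_vec_def)
    ultimately have "(\<Sum>j\<in>UNIV. h j (real_vec (load x) $ j)) < (\<Sum>j\<in>UNIV. h j (real_vec u $ j))"
      by (intro sum_strict_mono_ex1) auto
    with min x(1) show False by (force simp: is_arg_min_linorder not_le[symmetric])
  qed
  with x show ?thesis using that by blast
qed

theorem corollary6p5:
  fixes f :: "'n::finite \<Rightarrow> 'e::finite set \<Rightarrow> int"
    and X :: "'n \<Rightarrow> (int ^ 'e) set"
    and c :: "'n \<Rightarrow> 'e \<Rightarrow> real \<Rightarrow> real"
    and u :: "int ^ 'e"
  assumes "\<And>i. integral_polymatroid_rank (f i)"
    and "\<And>i. X i = integral_base_polyhedron (f i)"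
    and "\<And>i. X i \<subseteq> {y. \<forall>j. y $ j \<in> {0, 1}}"
    and "\<And>i j. mono_on {0..} (c i j)"
    and "minimal_for X u"
  shows "enforceable X c u"
proof -
  \<comment> \<open>Costs are frozen at the target load, which makes the total weight separable over
    players.\<close>
  define w where "w i j = c i j (u $ j)" for i j
  define total where "total x = (\<Sum>i\<in>UNIV. \<Sum>j\<in>UNIV. w i j * x i $ j)" for x :: "'n \<Rightarrow> int ^ 'e"
  let ?F = "{x \<in> profiles X. load x = u}"
  have "finite ?F" using finite_binary_profiles[of X] assms(3) by simp
  moreover have "?F \<noteq> {}" using minimal_for_imp_load[OF assms(5)] by blast
  ultimately obtain x where x: "x \<in> profiles X" "load x = u"
    and least: "\<And>x'. x' \<in> profiles X \<Longrightarrow> load x' = u \<Longrightarrow> total x \<le> total x'"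
    using ex_is_arg_min_if_finite[of ?F total] by (force simp: is_arg_min_linorder)
  have base: "x i \<in> integral_base_polyhedron (f i)" for i
    using x(1) assms(2) by (auto simp: profiles_def)
  obtain p where p: "\<And>i a b. exchangeable (f i) (x i) a b \<Longrightarrow> w i a + p a \<le> w i b + p b"
  proof (rule prices_for_cheapest_profile[OF assms(1) base, where w = w])
    fix x' :: "'n \<Rightarrow> int ^ 'e"
    assume "\<And>i. x' i \<in> integral_base_polyhedron (f i)" "load x' = load x"
    then show "(\<Sum>i\<in>UNIV. \<Sum>j\<in>UNIV. w i j * x i $ j) \<le> (\<Sum>i\<in>UNIV. \<Sum>j\<in>UNIV. w i j * x' i $ j)"
      using least[of x'] x assms(2) by (simp add: total_def profiles_def)
  qed blast
  \<comment> \<open>Exchange conditions involve only price differences, so a common shift makes the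
    prices nonnegative.\<close>
  define q where "q j = p j - Min (range p)" for j
  have binary: "y $ j = 0 \<or> y $ j = 1" if "y \<in> X i" for y i j
    using assms(3)[of i] that by auto
  \<comment> \<open>Needed because the costs are monotone on nonnegative arguments only.\<close>
  have u_nonneg: "0 \<le> u $ j" for j
  proof -
    have "0 \<le> x i $ j" for i
      using binary[of "x i" i j] x(1) by (auto simp: profiles_def)
    then have "0 \<le> (\<Sum>i\<in>UNIV. x i $ j)"
      by (intro sum_nonneg) simp
    then show ?thesis using x(2) by (simp add: load_def flip: sum_component)
  qed
  define cost where "cost i y = player_cost c i (load (x(i := y))) y +
      (\<Sum>j\<in>UNIV. q j * real_vec y $ j)" for i y
  have cost_x: "cost i (x i) = (\<Sum>j\<in>UNIV. (w i j + q j) * x i $ j)" for i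
    by (simp add: cost_def player_cost_def real_vec_def x(2) w_def distrib_right sum.distrib)
  have cost_deviation: "(\<Sum>j\<in>UNIV. (w i j + q j) * y $ j) \<le> cost i y" if y: "y \<in> X i" for i y
  proof -
    have "w i j * y $ j \<le> c i j (load (x(i := y)) $ j) * y $ j" for j
    proof (cases "y $ j = 0")
      case False
      \<comment> \<open>Here \<open>y $ j = 1\<close>, the largest value \<open>x i $ j\<close> can
        take, so the deviation cannot lower the load on \<open>j\<close>.\<close>
      then have "x i $ j \<le> y $ j"
        using binary[OF y, of j] binary[of "x i" i j] x(1) by (auto simp: profiles_def)
      then have "u $ j \<le> load (x(i := y)) $ j"
        unfolding x(2)[symmetric] load_def sum_component by (intro sum_mono) auto
      then have "w i j \<le> c i j (load (x(i := y)) $ j)"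
        unfolding w_def using u_nonneg[of j] by (intro mono_onD[OF assms(4)]) auto
      then show ?thesis using False binary[OF y, of j] by auto
    qed simp
    then have "(\<Sum>j\<in>UNIV. w i j * y $ j) \<le> (\<Sum>j\<in>UNIV. c i j (load (x(i := y)) $ j) * y $ j)"
      by (rule sum_mono)
    then show ?thesis
      by (simp add: cost_def player_cost_def real_vec_def distrib_right sum.distrib)
  qed
  have "is_arg_min (cost i) (\<lambda>y. y \<in> X i) (x i)" for i
  proof -
    have "cost i (x i) \<le> cost i y" if "y \<in> X i" for y
    proof -
      have "cost i (x i) \<le> (\<Sum>j\<in>UNIV. (w i j + q j) * y $ j)"
        unfolding cost_x
      proof (rule base_optimal_if_exchange_optimal[OF assms(1) base])
        show "y \<in> integral_base_polyhedron (f i)" using that assms(2) by simp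
        show "w i a + q a \<le> w i b + q b" if "exchangeable (f i) (x i) a b" for a b
          using p[OF that] by (simp add: q_def)
      qed
      also have "\<dots> \<le> cost i y" by (rule cost_deviation[OF that])
      finally show ?thesis .
    qed
    then show ?thesis using x(1) by (simp add: is_arg_min_linorder profiles_def)
  qed
  moreover have "0 \<le> q j" for j
    by (simp add: q_def)
  ultimately show ?thesis
    unfolding enforceable_def cost_def using x
    by (intro exI[of _ "\<chi> j. q j"] exI[of _ x]) simp
qed

end
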